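(* Let $H\in\mathbb{R}^{n\times n}$ be symmetric, $c\in\mathbb{R}^n$, $\sigma>0$ and $p>2$. Then the function $g(x)=\frac12x^THx+c^Tx+\frac{\sigma}{p}\|x\|^p$ on $\mathbb{R}^n$ has at most one local-nonglobal minimizer.
   Context: $\|\cdot\|$ is the Euclidean norm. A local-nonglobal minimizer of $g$ is a local minimizer of $g$ over $\mathbb{R}^n$ that is not a global minimizer. The problem $\min_{x\in\mathbb{R}^n}g(x)$ is the $p$-regularized subproblem (p-RS). *)

theory Defs
  imports "HOL-Analysis.Analysis"
begin

definition prs_objective ::
    "real ^ 'n ^ 'n \<Rightarrow> real ^ 'n \<Rightarrow> real \<Rightarrow> real \<Rightarrow> real ^ 'n \<Rightarrow> real" where
  "prs_objective H c \<sigma> p x =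
     1 / 2 * (x \<bullet> (H *v x)) + c \<bullet> x + \<sigma> / p * norm x powr p"

definition local_minimizer :: "('a::topological_space \<Rightarrow> real) \<Rightarrow> 'a \<Rightarrow> bool" where
  "local_minimizer g x \<longleftrightarrow> (\<forall>\<^sub>F y in nhds x. g x \<le> g y)"

definition global_minimizer :: "('a \<Rightarrow> real) \<Rightarrow> 'a \<Rightarrow> bool" where
  "global_minimizer g x \<longleftrightarrow> (\<forall>y. g x \<le> g y)"

definition local_nonglobal_minimizer :: "('a::topological_space \<Rightarrow> real) \<Rightarrow> 'a \<Rightarrow> bool" where
  "local_nonglobal_minimizer g x \<longleftrightarrow> local_minimizer g x \<and> \<not> global_minimizer g x"

end

theory Submission
  imports Defs
begin

text \<open>
  Put \<open>shift x = \<sigma> \<parallel>x\<parallel>\<^bsup>p-2\<^esup>\<close> and \<open>A\<^sub>x = H + shift x I\<close>. A minimizer \<open>x\<close> satisfies \<open>A\<^sub>x x = -c\<close>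
  and is global as soon as \<open>A\<^sub>x\<close> is positive semidefinite; the second-order condition makes the form of
  \<open>A\<^sub>x\<close> nonnegative on the hyperplane orthogonal to \<open>x\<close>. So at a local-nonglobal minimizer \<open>A\<^sub>x\<close> has
  exactly one negative eigenvalue, and it turns out to be invertible. Two such minimizers with equal
  shifts therefore coincide.

  Suppose \<open>\<delta> = shift y - shift x > 0\<close>. Both \<open>A\<^sub>x\<close> and \<open>A\<^sub>y = A\<^sub>x + \<delta> I\<close> have a negative eigenvalue, so
  \<open>A\<^sub>x A\<^sub>y\<close> is positive semidefinite. With \<open>A\<^sub>x w = x\<close> and \<open>A\<^sub>x u = y\<close>, the Cauchy-Schwarz inequality
  for \<open>A\<^sub>x A\<^sub>y\<close> applied to \<open>w\<close> and \<open>u\<close> gives \<open>\<parallel>x\<parallel>\<^sup>4 \<le> (x \<bullet> y) (\<parallel>x\<parallel>\<^sup>2 + \<delta> (x \<bullet> w))\<close>, while the second-order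
  condition in the directions \<open>e + t w\<close>, \<open>e\<close> a negative direction, bounds \<open>x \<bullet> w\<close> from above. Together,
  \<open>\<parallel>x\<parallel> \<le> (1 - \<eta>) \<parallel>y\<parallel>\<close> for \<open>\<eta> = \<delta> / ((p - 2) shift x)\<close>, hence
  \<open>shift x exp (\<delta> / shift x) \<le> shift y = shift x (1 + \<delta> / shift x)\<close>, which is impossible.
\<close>

section \<open>Self-adjoint operators on a Euclidean space\<close>

locale self_adjoint =
  fixes A :: "'a::euclidean_space \<Rightarrow> 'a"
  assumes linear: "linear A"
    and sym: "x \<bullet> A y = A x \<bullet> y"
begin

lemma add: "A (x + y) = A x + A y"
  using linear by (rule linear_add)

lemma diff: "A (x - y) = A x - A y"
  using linear by (rule linear_diff)

lemma scale: "A (r *\<^sub>R x) = r *\<^sub>R A x"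
  using linear by (rule linear_cmul)

lemma form_commute: "x \<bullet> A y = y \<bullet> A x"
  by (metis sym inner_commute)

lemma form_line: "(x + t *\<^sub>R y) \<bullet> A (x + t *\<^sub>R y) = x \<bullet> A x + 2 * t * (y \<bullet> A x) + t\<^sup>2 * (y \<bullet> A y)"
  by (simp add: add scale inner_simps form_commute[of x y] power2_eq_square algebra_simps)

lemma shift: "self_adjoint (\<lambda>x. A x + r *\<^sub>R x)"
  by unfold_locales
     (auto intro!: linearI simp: add scale sym inner_simps algebra_simps)

text \<open>The form is nonnegative along the line \<open>x + t *\<^sub>R y\<close>, and one value
  of \<open>t\<close> suffices. As the form is only semidefinite, \<open>y \<bullet> A y = 0\<close>
  is a separate case, where it is affine in \<open>t\<close>.\<close>

lemma Cauchy_Schwarz: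
  assumes psd: "\<And>x. 0 \<le> x \<bullet> A x"
  shows "(y \<bullet> A x)\<^sup>2 \<le> (x \<bullet> A x) * (y \<bullet> A y)"
proof (cases "y \<bullet> A y = 0")
  case True
  have "y \<bullet> A x = 0"
  proof (rule ccontr)
    assume nz: "y \<bullet> A x \<noteq> 0"
    \<comment> \<open>Here the affine function takes the value \<open>-1\<close>.\<close>
    define t where "t = - (x \<bullet> A x + 1) / (2 * (y \<bullet> A x))"
    have "0 \<le> x \<bullet> A x + 2 * t * (y \<bullet> A x)"
      using psd[of "x + t *\<^sub>R y"] True by (simp add: form_line)
    also have "2 * t * (y \<bullet> A x) = - (x \<bullet> A x + 1)"
      using nz by (simp add: t_def)
    finally show False by simp
  qed
  then show ?thesis using True by simp
next
  case False
  then have pos: "0 < y \<bullet> A y" using psd[of y] by simp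
  define t where "t = - (y \<bullet> A x) / (y \<bullet> A y)"
  have "0 \<le> x \<bullet> A x + 2 * t * (y \<bullet> A x) + t\<^sup>2 * (y \<bullet> A y)"
    using psd[of "x + t *\<^sub>R y"] by (simp add: form_line)
  also have "\<dots> = x \<bullet> A x - (y \<bullet> A x)\<^sup>2 / (y \<bullet> A y)"
    using pos by (simp add: t_def field_simps power2_eq_square)
  finally show ?thesis using pos by (simp add: field_simps)
qed

lemma psd_null_vector:
  assumes "\<And>x. 0 \<le> x \<bullet> A x" and "v \<bullet> A v = 0"
  shows "A v = 0"
  using Cauchy_Schwarz[OF assms(1), of "A v" v] assms(2) by simp

text \<open>By compactness the form attains its minimum \<open>m\<close> on the unit sphere, at
  \<open>v\<close>. Then \<open>A - m I\<close> is positive semidefinite and its form vanishes at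
  \<open>v\<close>, so \<open>psd_null_vector\<close> makes \<open>v\<close> an eigenvector.\<close>

lemma least_eigenvector:
  obtains v m where "v \<noteq> 0" and "A v = m *\<^sub>R v" and "\<And>x. m * (x \<bullet> x) \<le> x \<bullet> A x"
proof -
  obtain b :: 'a where "b \<in> Basis" by (meson nonempty_Basis ex_in_conv)
  then have "sphere (0::'a) 1 \<noteq> {}" by (auto intro!: exI[of _ b])
  moreover have "continuous_on (sphere 0 1) (\<lambda>x. x \<bullet> A x)"
    by (intro continuous_intros linear_continuous_on linear_conv_bounded_linear[THEN iffD1] linear)
  ultimately obtain v where v: "v \<in> sphere 0 1"
    and le: "\<And>y. y \<in> sphere 0 1 \<Longrightarrow> v \<bullet> A v \<le> y \<bullet> A y"
    using continuous_attains_inf[of "sphere (0::'a) 1"] compact_sphere by blast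
  define m where "m = v \<bullet> A v"
  have vv: "v \<bullet> v = 1" using v by (simp add: norm_eq_1)
  have ray: "m * (x \<bullet> x) \<le> x \<bullet> A x" for x
  proof (cases "x = 0")
    case False
    then have "(norm x)\<^sup>2 > 0" by simp
    moreover have "m \<le> (x \<bullet> A x) / (norm x)\<^sup>2"
      using le[of "x /\<^sub>R norm x"] False
      by (simp add: m_def scale power2_eq_square divide_inverse mult.commute mult.left_commute)
    ultimately show ?thesis by (simp add: field_simps dot_square_norm)
  qed simp
  interpret B: self_adjoint "\<lambda>x. A x + (-m) *\<^sub>R x" by (rule shift)
  have "A v + (-m) *\<^sub>R v = 0"
    by (rule B.psd_null_vector) (use ray in \<open>auto simp: inner_simps m_def vv\<close>)
  then have "A v = m *\<^sub>R v" by simp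
  moreover have "v \<noteq> 0" using vv by auto
  ultimately show thesis using ray that by blast
qed

text \<open>A plane on which the form is negative semidefinite meets the hyperplane orthogonal to \<open>x\<close>.\<close>

lemma positive_on_orthogonal:
  assumes orth: "\<And>d. d \<bullet> x = 0 \<Longrightarrow> 0 \<le> d \<bullet> A d"
    and e: "e \<bullet> A e < 0" and f: "f \<bullet> A e = 0"
  shows "0 \<le> f \<bullet> A f"
proof (rule ccontr)
  assume neg: "\<not> 0 \<le> f \<bullet> A f"
  then have fx: "f \<bullet> x \<noteq> 0" using orth by auto
  define t where "t = - (e \<bullet> x) / (f \<bullet> x)"
  have "0 \<le> (e + t *\<^sub>R f) \<bullet> A (e + t *\<^sub>R f)"
    by (rule orth) (use fx in \<open>simp add: t_def inner_simps\<close>)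
  also have "\<dots> = e \<bullet> A e + t\<^sup>2 * (f \<bullet> A f)" by (simp add: form_line f)
  also have "\<dots> < 0" using e neg by (smt (verit) mult_nonneg_nonpos zero_le_power2)
  finally show False by simp
qed

text \<open>The expression is the form of \<open>A (A + \<delta> I)\<close>. On the least
  eigenvector its eigenvalue \<open>m * (m + \<delta>)\<close> is a product of two negative numbers;
  on the orthogonal complement the form of \<open>A\<close> is nonnegative by
  \<open>positive_on_orthogonal\<close>.\<close>

lemma product_form_nonneg:
  assumes orth: "\<And>d. d \<bullet> x = 0 \<Longrightarrow> 0 \<le> d \<bullet> A d"
    and neg: "e \<bullet> A e + \<delta> * (e \<bullet> e) < 0" and "0 \<le> \<delta>"
  shows "0 \<le> A z \<bullet> A z + \<delta> * (z \<bullet> A z)"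
proof -
  obtain v m where v: "v \<noteq> 0" "A v = m *\<^sub>R v" and ray: "\<And>x. m * (x \<bullet> x) \<le> x \<bullet> A x"
    by (rule least_eigenvector) blast
  have "(m + \<delta>) * (e \<bullet> e) < 0" using ray[of e] neg by (simp add: algebra_simps)
  then have m\<delta>: "m + \<delta> < 0" by (smt (verit) inner_ge_zero mult_nonneg_nonneg)
  have vv: "0 < v \<bullet> v" using v by simp
  define t where "t = (z \<bullet> v) / (v \<bullet> v)"
  define w where "w = z - t *\<^sub>R v"
  have wv: "w \<bullet> v = 0" "v \<bullet> w = 0" using vv by (simp_all add: w_def t_def inner_simps inner_commute)
  have vAw: "v \<bullet> A w = 0" using form_commute[of v w] v(2) wv by simp
  have z: "z = w + t *\<^sub>R v" by (simp add: w_def)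
  have "v \<bullet> A v < 0" using v vv m\<delta> \<open>0 \<le> \<delta>\<close> by (simp add: mult_less_0_iff)
  then have w: "0 \<le> w \<bullet> A w"
    using positive_on_orthogonal[OF orth, where e = v and f = w] by (simp add: v wv)
  have "A z \<bullet> A z = A w \<bullet> A w + (t * m)\<^sup>2 * (v \<bullet> v)"
    using vAw by (simp add: z add scale v inner_simps power2_eq_square inner_commute algebra_simps)
  moreover have "z \<bullet> A z = w \<bullet> A w + t\<^sup>2 * m * (v \<bullet> v)"
    unfolding z form_line using vAw v by (simp add: inner_commute algebra_simps)
  ultimately have "A z \<bullet> A z + \<delta> * (z \<bullet> A z)
      = A w \<bullet> A w + \<delta> * (w \<bullet> A w) + t\<^sup>2 * (v \<bullet> v) * (m * (m + \<delta>))"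
    by (simp add: power2_eq_square algebra_simps)
  moreover have "0 \<le> m * (m + \<delta>)" using m\<delta> \<open>0 \<le> \<delta>\<close> by (simp add: mult_nonpos_nonpos)
  ultimately show ?thesis using w \<open>0 \<le> \<delta>\<close> by simp
qed

end

section \<open>Calculus preliminaries\<close>

lemma local_min_derivatives:
  fixes f f' :: "real \<Rightarrow> real"
  assumes min: "\<forall>\<^sub>F t in nhds a. f a \<le> f t"
    and f: "\<forall>\<^sub>F t in nhds a. (f has_real_derivative f' t) (at t)"
    and f': "(f' has_real_derivative D) (at a)"
  shows "f' a = 0" and "0 \<le> D"
proof -
  obtain e where "e > 0" and e: "\<And>t. dist t a < e \<Longrightarrow> f a \<le> f t \<and> (f has_real_derivative f' t) (at t)"
    using eventually_conj[OF min f] unfolding eventually_nhds_metric by blast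
  show f'a: "f' a = 0"
    by (rule DERIV_local_min[of f _ a e]) (use e \<open>e > 0\<close> in \<open>auto simp: dist_real_def abs_minus_commute\<close>)
  show "0 \<le> D"
  proof (rule ccontr)
    assume "\<not> 0 \<le> D"
    \<comment> \<open>A negative derivative of \<open>f'\<close> makes \<open>f'\<close> negative
      just to the right of its zero \<open>a\<close>, so \<open>f\<close> falls below
      \<open>f a\<close> there.\<close>
    then obtain d where "d > 0" and d: "\<And>h. 0 < h \<Longrightarrow> h < d \<Longrightarrow> f' (a + h) < 0"
      using DERIV_neg_dec_right[OF f'] f'a by auto
    define b where "b = min d e / 2"
    have b: "0 < b" "b < d" "b < e" using \<open>d > 0\<close> \<open>e > 0\<close> by (auto simp: b_def)
    have "f a > f (a + b)"
    proof (rule DERIV_neg_imp_decreasing_open[of a "a + b" f])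
      show "a < a + b" using b by simp
      show "\<exists>y. DERIV f t :> y \<and> y < 0" if "a < t" "t < a + b" for t
        using e[of t] d[of "t - a"] b that by (auto simp: dist_real_def)
      show "continuous_on {a..a + b} f"
      proof (rule DERIV_atLeastAtMost_imp_continuous_on)
        show "\<exists>y. DERIV f t :> y" if "a \<le> t" "t \<le> a + b" for t
          using e[of t] b that by (auto simp: dist_real_def)
      qed
    qed
    then show False using e[of "a + b"] b by (simp add: dist_real_def)
  qed
qed

lemma norm_powr_eq_inner_powr: "norm (x::'a::real_inner) powr p = (x \<bullet> x) powr (p / 2)"
proof -
  have "norm x = (x \<bullet> x) powr (1 / 2)"
    by (simp add: norm_eq_sqrt_inner powr_half_sqrt)
  then show ?thesis by (simp add: powr_powr)
qed

section \<open>The regularized objective and a sufficient condition for global minimality\<close>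

locale p_regularized = H: self_adjoint H for H :: "'a::euclidean_space \<Rightarrow> 'a" +
  fixes c :: 'a and \<sigma> p :: real
  assumes \<sigma>: "0 < \<sigma>" and p: "2 < p"
begin

definition obj :: "'a \<Rightarrow> real" where
  "obj x = 1 / 2 * (x \<bullet> H x) + c \<bullet> x + \<sigma> / p * norm x powr p"

definition shift :: "'a \<Rightarrow> real" where
  "shift x = \<sigma> * norm x powr (p - 2)"

definition shifted :: "'a \<Rightarrow> 'a \<Rightarrow> 'a" where
  "shifted x d = H d + shift x *\<^sub>R d"

lemma self_adjoint_shifted: "self_adjoint (shifted x)"
  using H.shift[of "shift x"] by (simp add: shifted_def[abs_def])

text \<open>Tangent inequality at \<open>(norm x)\<^sup>2\<close> for the convex function that sends
  \<open>s\<close> to \<open>\<sigma> / p * s powr (p / 2)\<close>, whose slope there is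
  \<open>shift x / 2\<close>. Young's inequality with exponents \<open>p / 2\<close> and
  \<open>p / (p - 2)\<close> proves it, including the case \<open>x = 0\<close>.\<close>

lemma norm_power_tangent:
  fixes x y :: 'a
  shows "shift x / 2 * ((norm y)\<^sup>2 - (norm x)\<^sup>2) \<le> \<sigma> / p * (norm y powr p - norm x powr p)"
proof -
  have "(norm y)\<^sup>2 * norm x powr (p - 2)
      \<le> ((norm y)\<^sup>2) powr (p / 2) / (p / 2) + (norm x powr (p - 2)) powr (p / (p - 2)) / (p / (p - 2))"
    by (rule Youngs_inequality) (use p in \<open>auto simp: field_simps\<close>)
  also have "((norm y)\<^sup>2) powr (p / 2) = norm y powr p"
    unfolding norm_powr_eq_inner_powr power2_norm_eq_inner by (rule refl)
  also have "(norm x powr (p - 2)) powr (p / (p - 2)) = norm x powr p"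
    using p by (simp add: powr_powr)
  finally have young: "(norm y)\<^sup>2 * norm x powr (p - 2) \<le> norm y powr p / (p / 2) + norm x powr p / (p / (p - 2))" .
  have "norm x powr p = (norm x)\<^sup>2 * norm x powr (p - 2)"
    using p by (cases "x = 0") (simp_all add: powr_diff)
  then have "norm x powr (p - 2) / 2 * ((norm y)\<^sup>2 - (norm x)\<^sup>2) \<le> 1 / p * (norm y powr p - norm x powr p)"
    using young p by (simp add: field_simps)
  from mult_left_mono[OF this, of \<sigma>] show ?thesis
    using \<sigma> by (simp add: shift_def diff_divide_distrib algebra_simps)
qed

text \<open>Stationarity eliminates \<open>c\<close> and completes the square. The remaining bracket
  is nonnegative by \<open>norm_power_tangent\<close> and vanishes when
  \<open>norm y = norm x\<close>.\<close>

lemma obj_diff: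
  assumes "shifted x x + c = 0"
  shows "obj y - obj x = 1 / 2 * ((y - x) \<bullet> shifted x (y - x))
    + (\<sigma> / p * (norm y powr p - norm x powr p) - shift x / 2 * ((norm y)\<^sup>2 - (norm x)\<^sup>2))"
proof -
  have c: "c = - (H x + shift x *\<^sub>R x)" using assms unfolding shifted_def by (metis add_eq_0_iff)
  then have cz: "c \<bullet> z = - (z \<bullet> H x + shift x * (x \<bullet> z))" for z
    by (simp add: inner_simps inner_commute[of "H x"])
  show ?thesis
    by (simp add: obj_def shifted_def cz H.diff inner_simps H.form_commute[of x y] inner_commute[of y x]
        power2_norm_eq_inner diff_divide_distrib add_divide_distrib algebra_simps)
qed

lemma global_if_psd:
  assumes "shifted x x + c = 0" and "\<And>d. 0 \<le> d \<bullet> shifted x d"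
  shows "global_minimizer obj x"
  unfolding global_minimizer_def
proof
  fix y
  show "obj x \<le> obj y"
    using obj_diff[OF assms(1), of y] assms(2)[of "y - x"] norm_power_tangent[of x y] by (simp add: right_diff_distrib)
qed

section \<open>Necessary conditions at a local minimizer\<close>

definition curvature :: "'a \<Rightarrow> real" where
  "curvature x = (p - 2) * shift x / (norm x)\<^sup>2"

lemma line_eventually:
  assumes "local_minimizer obj x"
  shows "\<forall>\<^sub>F t in nhds 0. obj x \<le> obj (x + t *\<^sub>R d)"
proof -
  have "((\<lambda>t. x + t *\<^sub>R d) \<longlongrightarrow> x + 0 *\<^sub>R d) (nhds 0)"
    by (intro tendsto_intros filterlim_ident)
  then show ?thesis
    using assms unfolding local_minimizer_def by (auto dest: eventually_compose_filterlim)
qed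

text \<open>First and second derivative of \<open>obj\<close> along the line through
  \<open>x\<close> in direction \<open>d\<close>: the Hessian at \<open>x\<close> is the shifted
  operator plus \<open>curvature x\<close> times the rank-one operator of \<open>x\<close>. For
  \<open>x \<noteq> 0\<close> the squared norm \<open>\<rho>\<close> stays positive near
  \<open>0\<close>, where real powers are differentiable.\<close>

lemma local_min_conditions:
  assumes min: "local_minimizer obj x" and x: "x \<noteq> 0"
  shows "d \<bullet> (shifted x x + c) = 0"
    and "0 \<le> d \<bullet> shifted x d + curvature x * (x \<bullet> d)\<^sup>2"
proof -
  define \<rho> where "\<rho> t = x \<bullet> x + 2 * t * (x \<bullet> d) + t\<^sup>2 * (d \<bullet> d)" for t
  define f where "f t = (1 / 2 * (x \<bullet> H x) + c \<bullet> x) + t * (d \<bullet> (H x + c)) + t\<^sup>2 / 2 * (d \<bullet> H d)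
      + \<sigma> / p * \<rho> t powr (p / 2)" for t
  define f' where "f' t = d \<bullet> (H x + c) + t * (d \<bullet> H d)
      + \<sigma> / 2 * (\<rho> t powr (p / 2 - 1) * (2 * (x \<bullet> d) + 2 * t * (d \<bullet> d)))" for t
  define D where "D = d \<bullet> H d
      + \<sigma> / 2 * ((p / 2 - 1) * (x \<bullet> x) powr (p / 2 - 2) * (2 * (x \<bullet> d))\<^sup>2 + (x \<bullet> x) powr (p / 2 - 1) * (2 * (d \<bullet> d)))"
  have f: "obj (x + t *\<^sub>R d) = f t" for t
  proof -
    have "(x + t *\<^sub>R d) \<bullet> (x + t *\<^sub>R d) = \<rho> t"
      by (simp add: \<rho>_def inner_simps inner_commute power2_eq_square algebra_simps)
    then show ?thesis
      unfolding obj_def f_def norm_powr_eq_inner_powr H.form_line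
      by (simp add: inner_simps inner_commute[of d c] algebra_simps)
  qed
  have \<rho>0: "\<rho> 0 > 0" and \<rho>0': "\<rho> 0 = x \<bullet> x" using x by (auto simp: \<rho>_def)
  have "(\<rho> \<longlongrightarrow> \<rho> 0) (nhds 0)"
    unfolding \<rho>_def by (intro tendsto_intros filterlim_ident)
  then have \<rho>pos: "\<forall>\<^sub>F t in nhds 0. 0 < \<rho> t"
    using \<rho>0 by (rule order_tendstoD)
  have \<rho>': "(\<rho> has_real_derivative (2 * (x \<bullet> d) + 2 * t * (d \<bullet> d))) (at t)" for t
    unfolding \<rho>_def by (auto intro!: derivative_eq_intros)
  have \<rho>_powr: "((\<lambda>t. \<rho> t powr a) has_real_derivative
      a * \<rho> t powr (a - 1) * (2 * (x \<bullet> d) + 2 * t * (d \<bullet> d))) (at t)" if "\<rho> t > 0" for t a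
    using DERIV_chain2[OF has_real_derivative_powr[OF that] \<rho>'] by simp
  have df: "(f has_real_derivative f' t) (at t)" if "\<rho> t > 0" for t
    unfolding f_def f'_def
    by (rule derivative_eq_intros \<rho>_powr that refl | use p in \<open>simp add: field_simps; fail\<close>)+
  have df': "(f' has_real_derivative D) (at 0)"
    unfolding f'_def D_def
    by (rule derivative_eq_intros \<rho>_powr \<rho>0 refl | (simp add: \<rho>0' power2_eq_square algebra_simps; fail))+
  note nec = local_min_derivatives[of f 0 f' D]
  have ev: "\<forall>\<^sub>F t in nhds 0. f 0 \<le> f t"
    using line_eventually[OF min, of d] f[of 0] by (simp add: f)
  have ev': "\<forall>\<^sub>F t in nhds 0. (f has_real_derivative f' t) (at t)"
    using \<rho>pos by eventually_elim (rule df)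
  have powr1: "(x \<bullet> x) powr (p / 2 - 1) = norm x powr (p - 2)"
    by (simp add: norm_powr_eq_inner_powr diff_divide_distrib)
  have powr2: "(x \<bullet> x) powr (p / 2 - 2) = norm x powr (p - 2) / (norm x)\<^sup>2"
  proof -
    have "(x \<bullet> x) powr (p / 2 - 2) = (x \<bullet> x) powr (p / 2 - 1 - 1)" by simp
    also have "\<dots> = (x \<bullet> x) powr (p / 2 - 1) / (x \<bullet> x)" using x by (subst powr_diff) simp
    finally show ?thesis by (simp only: powr1 power2_norm_eq_inner)
  qed
  have "f' 0 = d \<bullet> (shifted x x + c)"
    by (simp add: f'_def \<rho>0' powr1 shifted_def shift_def inner_simps inner_commute)
  then show "d \<bullet> (shifted x x + c) = 0" using nec(1)[OF ev ev' df'] by simp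
  have "D = d \<bullet> shifted x d + curvature x * (x \<bullet> d)\<^sup>2"
    using x unfolding D_def powr1 powr2 shifted_def shift_def curvature_def
    by (simp add: inner_simps field_simps)
  then show "0 \<le> d \<bullet> shifted x d + curvature x * (x \<bullet> d)\<^sup>2" using nec(2)[OF ev ev' df'] by simp
qed

lemma local_min_stationary:
  assumes "local_minimizer obj x" and "x \<noteq> 0"
  shows "shifted x x + c = 0"
  using local_min_conditions(1)[OF assms, of "shifted x x + c"] by simp

text \<open>Dividing the increment of \<open>obj\<close> along a ray by \<open>t\<close> and letting
  \<open>t\<close> tend to \<open>0\<close> gives \<open>c = 0\<close>; dividing by the square of
  \<open>t\<close> then gives that \<open>H\<close> is positive semidefinite, since the norm term
  has order \<open>p > 2\<close>.\<close>

lemma local_min_zero_global: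
  assumes min: "local_minimizer obj 0"
  shows "global_minimizer obj 0"
proof (rule global_if_psd)
  have ev: "\<forall>\<^sub>F t in at_right 0. 0 \<le> t * (c \<bullet> d) + t\<^sup>2 * (1 / 2 * (d \<bullet> H d) + \<sigma> / p * norm d powr p * t powr (p - 2))" for d
  proof -
    have "\<forall>\<^sub>F t in at_right 0. obj 0 \<le> obj (0 + t *\<^sub>R d)"
      using line_eventually[OF min, of d] by (rule filter_leD[rotated]) (simp add: at_within_def)
    moreover have "\<forall>\<^sub>F t in at_right (0::real). 0 < t" by (rule eventually_at_right_less)
    ultimately show ?thesis
    proof eventually_elim
      case (elim t)
      have "t powr p = t\<^sup>2 * t powr (p - 2)" using elim by (simp add: powr_diff)
      then show ?case using elim
        by (simp add: obj_def H.scale powr_mult power2_eq_square algebra_simps)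
    qed
  qed
  have pos: "\<forall>\<^sub>F t in at_right (0::real). 0 < t" by (rule eventually_at_right_less)
  have lim: "((\<lambda>t::real. t powr (p - 2)) \<longlongrightarrow> 0) (at_right 0)"
    using p by (intro tendsto_eq_intros) (auto simp: eventually_at_right_less less_imp_le intro: eventually_mono[OF pos])
  have cd: "0 \<le> c \<bullet> d" for d
  proof (rule tendsto_lowerbound)
    show "\<forall>\<^sub>F t in at_right 0. 0 \<le> c \<bullet> d + t * (1 / 2 * (d \<bullet> H d) + \<sigma> / p * norm d powr p * t powr (p - 2))"
      using ev[of d] pos
    proof eventually_elim
      case (elim t)
      then have "0 \<le> t * (c \<bullet> d + t * (1 / 2 * (d \<bullet> H d) + \<sigma> / p * norm d powr p * t powr (p - 2)))"
        by (simp only: power2_eq_square distrib_left mult.assoc)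
      then show ?case using elim by (simp only: zero_le_mult_iff) auto
    qed
    have "((\<lambda>t. c \<bullet> d + t * (1 / 2 * (d \<bullet> H d) + \<sigma> / p * norm d powr p * t powr (p - 2)))
        \<longlongrightarrow> c \<bullet> d + 0 * (1 / 2 * (d \<bullet> H d) + \<sigma> / p * norm d powr p * 0)) (at_right 0)"
      by (intro tendsto_intros lim)
    then show "((\<lambda>t. c \<bullet> d + t * (1 / 2 * (d \<bullet> H d) + \<sigma> / p * norm d powr p * t powr (p - 2)))
        \<longlongrightarrow> c \<bullet> d) (at_right 0)" by simp
  qed simp
  have c: "c = 0" using cd[of "- c"] by (metis inner_gt_zero_iff inner_minus_right neg_0_le_iff_le not_le)
  then show "shifted 0 0 + c = 0" using H.scale[of 0 0] by (simp add: shifted_def)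
  have shift0: "shift 0 = 0" using p by (simp add: shift_def)
  show "0 \<le> d \<bullet> shifted 0 d" for d
  proof -
    have "0 \<le> 1 / 2 * (d \<bullet> H d)"
    proof (rule tendsto_lowerbound)
      show "\<forall>\<^sub>F t in at_right 0. 0 \<le> 1 / 2 * (d \<bullet> H d) + \<sigma> / p * norm d powr p * t powr (p - 2)"
        using ev[of d] pos by eventually_elim (auto simp: c zero_le_mult_iff)
      have "((\<lambda>t. 1 / 2 * (d \<bullet> H d) + \<sigma> / p * norm d powr p * t powr (p - 2))
          \<longlongrightarrow> 1 / 2 * (d \<bullet> H d) + \<sigma> / p * norm d powr p * 0) (at_right 0)"
        by (intro tendsto_intros lim)
      then show "((\<lambda>t. 1 / 2 * (d \<bullet> H d) + \<sigma> / p * norm d powr p * t powr (p - 2))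
          \<longlongrightarrow> 1 / 2 * (d \<bullet> H d)) (at_right 0)" by simp
    qed simp
    then show ?thesis by (simp add: shifted_def shift0)
  qed
qed

section \<open>The shifted operator at a local-nonglobal minimizer\<close>

lemma nonglobal_negative_direction:
  assumes "shifted x x + c = 0" and "\<not> global_minimizer obj x"
  obtains e where "e \<bullet> shifted x e < 0"
  using global_if_psd assms by (meson not_le)

lemma local_nonglobal_nonzero:
  assumes "local_nonglobal_minimizer obj x"
  shows "x \<noteq> 0"
  using assms local_min_zero_global unfolding local_nonglobal_minimizer_def by blast

lemma local_min_orthogonal:
  assumes "local_minimizer obj x" and "x \<noteq> 0" and "d \<bullet> x = 0"
  shows "0 \<le> d \<bullet> shifted x d"
  using local_min_conditions(2)[OF assms(1,2), of d] assms(3) by (simp add: inner_commute)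

text \<open>A null vector \<open>d\<close> and a negative direction \<open>u\<close> of the form yield a curve
  \<open>x + s u + \<beta>(s) d\<close> on the sphere through \<open>x\<close>; the objective decreases along it, because
  on that sphere it differs from \<open>obj x\<close> only by the quadratic form.\<close>

lemma shifted_kernel_trivial:
  assumes ng: "local_nonglobal_minimizer obj x" and null: "shifted x d = 0"
  shows "d = 0"
proof (rule ccontr)
  assume d: "d \<noteq> 0"
  have min: "local_minimizer obj x" using ng by (simp add: local_nonglobal_minimizer_def)
  note x = local_nonglobal_nonzero[OF ng]
  note orth = local_min_orthogonal[OF min x]
  note stat = local_min_stationary[OF min x]
  obtain e where e: "e \<bullet> shifted x e < 0"
    using nonglobal_negative_direction[OF stat] ng by (auto simp: local_nonglobal_minimizer_def)
  interpret A: self_adjoint "shifted x" by (rule self_adjoint_shifted)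
  have form: "(e + t *\<^sub>R d) \<bullet> shifted x (e + t *\<^sub>R d) = e \<bullet> shifted x e" for t
    using A.form_commute[of d e] by (simp add: A.form_line null)
  \<comment> \<open>Otherwise a multiple of \<open>d\<close> moves \<open>e\<close> into the
    hyperplane orthogonal to \<open>x\<close> without changing its negative form.\<close>
  have dx: "d \<bullet> x = 0"
  proof (rule ccontr)
    assume "d \<bullet> x \<noteq> 0"
    then have "(e + (- (e \<bullet> x) / (d \<bullet> x)) *\<^sub>R d) \<bullet> x = 0" by (simp add: inner_simps)
    from orth[OF this] show False using e by (simp only: form)
  qed
  have ex: "e \<bullet> x \<noteq> 0" using orth e by force
  \<comment> \<open>\<open>e\<close> without its component along \<open>d\<close>, scaled to
    \<open>u \<bullet> x = -1\<close>: moving along \<open>u\<close> first shrinks the norm, which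
    leaves room for a step along \<open>d\<close>.\<close>
  define u where "u = (- 1 / (e \<bullet> x)) *\<^sub>R (e + (- (e \<bullet> d) / (d \<bullet> d)) *\<^sub>R d)"
  have ux: "u \<bullet> x = -1" using ex dx by (simp add: u_def inner_simps)
  have ud: "u \<bullet> d = 0" using d by (simp add: u_def inner_simps)
  have "u \<bullet> shifted x u = (1 / (e \<bullet> x))\<^sup>2 * (e \<bullet> shifted x e)"
    unfolding u_def A.scale inner_scaleR_left inner_scaleR_right form by (simp add: power2_eq_square)
  then have uu: "u \<bullet> shifted x u < 0" using e ex by (simp add: mult_pos_neg)
  \<comment> \<open>The squared norm of \<open>x + s *\<^sub>R u\<close> falls short of that of
    \<open>x\<close> by exactly this numerator; the step along \<open>d\<close> restores it. The
    numerator is nonnegative for small \<open>s > 0\<close>.\<close>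
  define \<beta> where "\<beta> s = sqrt ((2 * s - s\<^sup>2 * (u \<bullet> u)) / (d \<bullet> d))" for s
  define y where "y s = x + s *\<^sub>R u + \<beta> s *\<^sub>R d" for s
  have "((\<lambda>s. y s) \<longlongrightarrow> x + 0 *\<^sub>R u + sqrt ((2 * 0 - 0\<^sup>2 * (u \<bullet> u)) / (d \<bullet> d)) *\<^sub>R d) (at_right 0)"
    unfolding y_def \<beta>_def by (intro tendsto_intros) (use d in simp)
  then have "(y \<longlongrightarrow> x) (at_right 0)" by simp
  with min have "\<forall>\<^sub>F s in at_right 0. obj x \<le> obj (y s)"
    unfolding local_minimizer_def by (rule eventually_compose_filterlim)
  moreover have "\<forall>\<^sub>F s in at_right (0::real). 0 < s" by (rule eventually_at_right_less)
  moreover have "\<forall>\<^sub>F s in at_right 0. s * (u \<bullet> u) < 2"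
  proof (rule order_tendstoD)
    show "((\<lambda>s. s * (u \<bullet> u)) \<longlongrightarrow> 0 * (u \<bullet> u)) (at_right 0)" by (intro tendsto_intros)
  qed simp
  ultimately have "\<forall>\<^sub>F s in at_right (0::real). False"
  proof eventually_elim
    case (elim s)
    have "0 \<le> s * (2 - s * (u \<bullet> u))" using elim by simp
    then have "0 \<le> 2 * s - s\<^sup>2 * (u \<bullet> u)" by (simp add: power2_eq_square algebra_simps)
    then have \<beta>2: "(\<beta> s)\<^sup>2 * (d \<bullet> d) = 2 * s - s\<^sup>2 * (u \<bullet> u)"
      using d by (simp add: \<beta>_def)
    have "y s \<bullet> y s = x \<bullet> x + 2 * s * (u \<bullet> x) + s\<^sup>2 * (u \<bullet> u) + (\<beta> s)\<^sup>2 * (d \<bullet> d)"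
      using dx ud by (simp add: y_def inner_simps inner_commute power2_eq_square algebra_simps)
    then have ny: "norm (y s) = norm x" by (simp add: norm_eq_sqrt_inner ux \<beta>2)
    have "(y s - x) \<bullet> shifted x (y s - x) = s\<^sup>2 * (u \<bullet> shifted x u)"
      using A.form_commute[of d u] by (simp add: y_def A.add A.scale null inner_simps power2_eq_square)
    then have "obj (y s) - obj x = 1 / 2 * (s\<^sup>2 * (u \<bullet> shifted x u))"
      using obj_diff[OF stat, of "y s"] by (simp add: ny)
    moreover have "s\<^sup>2 * (u \<bullet> shifted x u) < 0" using uu elim by (simp add: mult_pos_neg)
    ultimately show False using elim by simp
  qed
  then show False by simp
qed

text \<open>For invertible \<open>shifted x\<close>, the determinant of the Hessian is that of
  \<open>shifted x\<close> times \<open>1 + curvature x * (x \<bullet> w)\<close>. A positive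
  semidefinite Hessian and a single negative eigenvalue of \<open>shifted x\<close> thus force the
  sign. The proof avoids determinants by testing the Hessian on \<open>w\<close> and on
  \<open>e + t *\<^sub>R w\<close>.\<close>

lemma curvature_bound:
  assumes min: "local_minimizer obj x" and x: "x \<noteq> 0"
    and e: "e \<bullet> shifted x e < 0" and w: "shifted x w = x"
  shows "1 + curvature x * (x \<bullet> w) \<le> 0"
proof (rule ccontr)
  assume neg: "\<not> ?thesis"
  note cond = local_min_conditions(2)[OF min x]
  interpret A: self_adjoint "shifted x" by (rule self_adjoint_shifted)
  have Awe: "w \<bullet> shifted x e = e \<bullet> x" using A.form_commute[of w e] w by simp
  have line: "0 \<le> e \<bullet> shifted x e + 2 * t * (e \<bullet> x) + t\<^sup>2 * (x \<bullet> w)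
      + curvature x * (e \<bullet> x + t * (x \<bullet> w))\<^sup>2" for t
    using cond[of "e + t *\<^sub>R w"] unfolding A.form_line Awe w
    by (simp add: inner_simps inner_commute)
  consider "x \<bullet> w < 0" | "x \<bullet> w = 0" | "x \<bullet> w > 0" by linarith
  then show False
  proof cases
    case 1
    have "0 \<le> (x \<bullet> w) * (1 + curvature x * (x \<bullet> w))"
      using cond[of w] w by (simp add: inner_commute power2_eq_square algebra_simps)
    then show False using 1 neg by (simp add: zero_le_mult_iff)
  next
    case 2
    \<comment> \<open>This \<open>t\<close> cancels the linear term against the curvature
      term.\<close>
    have "0 \<le> e \<bullet> shifted x e"
      using line[of "- curvature x * (e \<bullet> x) / 2"] 2 by (simp add: power2_eq_square algebra_simps)
    then show False using e by simp
  next
    case 3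
    \<comment> \<open>This \<open>t\<close> makes \<open>e + t *\<^sub>R w\<close> orthogonal to
      \<open>x\<close>, so the curvature term vanishes.\<close>
    then have "0 \<le> e \<bullet> shifted x e - (e \<bullet> x)\<^sup>2 / (x \<bullet> w)"
      using line[of "- (e \<bullet> x) / (x \<bullet> w)"] by (simp add: power2_eq_square algebra_simps)
    moreover have "0 \<le> (e \<bullet> x)\<^sup>2 / (x \<bullet> w)" using 3 by simp
    ultimately show False using e by simp
  qed
qed

section \<open>Comparison of two local-nonglobal minimizers\<close>

lemma shift_pos: "x \<noteq> 0 \<Longrightarrow> 0 < shift x"
  using \<sigma> by (simp add: shift_def)

lemma shift_not_less:
  assumes nx: "local_nonglobal_minimizer obj x" and ny: "local_nonglobal_minimizer obj y"
  shows "\<not> shift x < shift y"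
proof
  assume less: "shift x < shift y"
  define \<delta> where "\<delta> = shift y - shift x"
  have \<delta>: "\<delta> > 0" using less by (simp add: \<delta>_def)
  note x = local_nonglobal_nonzero[OF nx] and y = local_nonglobal_nonzero[OF ny]
  have minx: "local_minimizer obj x" and miny: "local_minimizer obj y"
    using nx ny by (simp_all add: local_nonglobal_minimizer_def)
  note statx = local_min_stationary[OF minx x] and staty = local_min_stationary[OF miny y]
  interpret A: self_adjoint "shifted x" by (rule self_adjoint_shifted)
  have shifted_y: "shifted y z = shifted x z + \<delta> *\<^sub>R z" for z
    by (simp add: shifted_def \<delta>_def algebra_simps)
  have "inj (shifted x)"
    by (subst linear_injective_0[OF A.linear]) (use shifted_kernel_trivial[OF nx] in blast)
  then have "surj (shifted x)" by (rule linear_inj_imp_surj[OF A.linear])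
  then obtain w u where w: "shifted x w = x" and u: "shifted x u = y" by (metis surjD)
  obtain e where e: "e \<bullet> shifted x e < 0"
    using nonglobal_negative_direction[OF statx] nx by (auto simp: local_nonglobal_minimizer_def)
  obtain e' where e': "e' \<bullet> shifted y e' < 0"
    using nonglobal_negative_direction[OF staty] ny by (auto simp: local_nonglobal_minimizer_def)
  have eq: "shifted x y + \<delta> *\<^sub>R y = shifted x x"
    using statx staty by (metis shifted_y add_right_cancel)
  define B where "B z = shifted x (shifted x z + \<delta> *\<^sub>R z)" for z
  interpret B: self_adjoint B
    by unfold_locales
       (auto intro!: linearI simp: B_def A.add A.scale A.sym inner_simps algebra_simps)
  \<comment> \<open>Both minimizers enter: \<open>x\<close> gives nonnegativity on its orthogonal
    hyperplane, \<open>y\<close> gives the direction \<open>e'\<close>, still negative after adding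
    \<open>\<delta>\<close>.\<close>
  have psd: "0 \<le> z \<bullet> B z" for z
    using A.product_form_nonneg[OF local_min_orthogonal[OF minx x], where e = e' and \<delta> = \<delta> and z = z] e' \<delta>
    by (simp add: B_def A.sym shifted_y inner_simps)
  have wBw: "w \<bullet> B w = x \<bullet> x + \<delta> * (x \<bullet> w)"
    by (simp add: B_def A.sym w inner_simps)
  \<comment> \<open>By \<open>eq\<close>, \<open>B u\<close> equals \<open>shifted x x\<close>, so
    pairing it with \<open>u\<close> or \<open>w\<close> leaves only inner products of
    \<open>x\<close> and \<open>y\<close>.\<close>
  have uBu: "u \<bullet> B u = x \<bullet> y"
  proof -
    have "u \<bullet> B u = u \<bullet> (shifted x y + \<delta> *\<^sub>R y)" by (simp add: B_def A.add A.scale u)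
    also have "\<dots> = x \<bullet> y" by (simp add: eq A.sym u inner_commute)
    finally show ?thesis .
  qed
  have wBu: "w \<bullet> B u = x \<bullet> x"
  proof -
    have "w \<bullet> B u = w \<bullet> (shifted x y + \<delta> *\<^sub>R y)" by (simp add: B_def A.add A.scale u)
    also have "\<dots> = x \<bullet> x" by (simp add: eq A.sym w)
    finally show ?thesis .
  qed
  have CS: "(x \<bullet> x)\<^sup>2 \<le> (x \<bullet> y) * (x \<bullet> x + \<delta> * (x \<bullet> w))"
    using B.Cauchy_Schwarz[OF psd, of w u] by (simp add: wBw uBu wBu)
  \<comment> \<open>\<open>curvature_bound\<close> turns into
    \<open>\<delta> * (x \<bullet> w) \<le> - \<eta> * r\<^sup>2\<close>.\<close>
  define \<eta> where "\<eta> = \<delta> / ((p - 2) * shift x)"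
  define r where "r = norm x"
  have r: "r > 0" using x by (simp add: r_def)
  have xx: "x \<bullet> x = r\<^sup>2" by (simp add: r_def dot_square_norm)
  have "1 + curvature x * (x \<bullet> w) \<le> 0" by (rule curvature_bound[OF minx x e w])
  then have "x \<bullet> w \<le> - (r\<^sup>2 / ((p - 2) * shift x))"
    using p shift_pos[OF x] r by (simp add: curvature_def r_def[symmetric] field_simps)
  from mult_left_mono[OF this, of \<delta>] have bound: "x \<bullet> x + \<delta> * (x \<bullet> w) \<le> r\<^sup>2 * (1 - \<eta>)"
    using \<delta> by (simp add: xx \<eta>_def algebra_simps)
  have "(r\<^sup>2)\<^sup>2 \<le> (x \<bullet> y) * (x \<bullet> x + \<delta> * (x \<bullet> w))" using CS by (simp add: xx)
  \<comment> \<open>Bounding both factors at once needs the second one nonnegative; it is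
    \<open>w \<bullet> B w\<close>.\<close>
  also have "\<dots> \<le> (r * norm y) * (r\<^sup>2 * (1 - \<eta>))"
    using psd[of w] bound Cauchy_Schwarz_ineq2[of x y]
    by (intro mult_mono) (auto simp: wBw r_def)
  finally have "r\<^sup>2 * r * r \<le> r\<^sup>2 * r * (norm y * (1 - \<eta>))"
    by (simp add: power2_eq_square algebra_simps)
  then have "r \<le> norm y * (1 - \<eta>)" using r by simp
  also have "\<dots> \<le> norm y * exp (- \<eta>)"
    using exp_ge_add_one_self[of "- \<eta>"] by (intro mult_left_mono) auto
  \<comment> \<open>The power \<open>p - 2\<close> cancels the factor \<open>p - 2\<close> in the
    denominator of \<open>\<eta>\<close> and turns norms into shifts, up to
    \<open>\<sigma>\<close>.\<close>
  finally have "r powr (p - 2) \<le> (norm y * exp (- \<eta>)) powr (p - 2)"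
    using r p by (intro powr_mono2) auto
  also have "\<dots> = norm y powr (p - 2) * exp (- (\<delta> / shift x))"
    using p by (simp add: powr_mult exp_powr_real \<eta>_def)
  finally have "shift x \<le> shift y * exp (- (\<delta> / shift x))"
    using \<sigma> by (simp add: shift_def r_def)
  then have "shift x * exp (\<delta> / shift x) \<le> shift y"
    by (simp add: exp_minus field_simps)
  moreover have "1 + \<delta> / shift x < exp (\<delta> / shift x)"
    using \<delta> shift_pos[OF x] exp_minus_greater[of "- (\<delta> / shift x)"] by simp
  then have "shift x * (1 + \<delta> / shift x) < shift x * exp (\<delta> / shift x)"
    using shift_pos[OF x] by simp
  moreover have "shift x * (1 + \<delta> / shift x) = shift y"
    using shift_pos[OF x] by (simp add: \<delta>_def field_simps)
  ultimately show False by simp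
qed

lemma local_nonglobal_unique:
  assumes nx: "local_nonglobal_minimizer obj x" and ny: "local_nonglobal_minimizer obj y"
  shows "x = y"
proof -
  have eq: "shift x = shift y" using shift_not_less[OF nx ny] shift_not_less[OF ny nx] by simp
  have "shifted x x + c = 0" "shifted y y + c = 0"
    using local_min_stationary local_nonglobal_nonzero nx ny by (auto simp: local_nonglobal_minimizer_def)
  then have "shifted x x = shifted x y"
    using eq by (metis shifted_def add_right_cancel)
  moreover interpret A: self_adjoint "shifted x" by (rule self_adjoint_shifted)
  have "shifted x (x - y) = shifted x x - shifted x y" by (rule A.diff)
  ultimately show ?thesis using shifted_kernel_trivial[OF nx, of "x - y"] by simp
qed

end

theorem theorem4:
  fixes H :: "real ^ 'n ^ 'n" and c :: "real ^ 'n" and \<sigma> p :: real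
  assumes "transpose H = H"
    and "\<sigma> > 0"
    and "p > 2"
  shows "\<exists>\<^sub>\<le>\<^sub>1 x. local_nonglobal_minimizer (prs_objective H c \<sigma> p) x"
proof -
  interpret p_regularized "(*v) H" c \<sigma> p
  proof
    show "x \<bullet> (H *v y) = (H *v x) \<bullet> y" for x y
      by (metis assms(1) dot_lmul_matrix transpose_matrix_vector)
  qed (use assms in \<open>simp_all add: matrix_vector_right_distrib matrix_vector_mult_scaleR\<close>)
  have "prs_objective H c \<sigma> p = obj"
    by (simp add: fun_eq_iff prs_objective_def obj_def)
  then show ?thesis
    using local_nonglobal_unique by (simp add: Uniq_def)
qed

end
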